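(* Let $(G,M,R)$ be a formal context. The functors $(-)^\Delta$ and $(-)^\Pi$ on $P(G)$, and similarly $(-)_\Pi$ and $(-)_\nabla$ on $P(M)^{\mathrm{op}}$, are left adjoints. Any composition of these will produce a closure operator on $P(G)$ by composing with the corresponding right adjoint.
   Context: A formal context $(G,M,R)$ consists of two sets $G,M$ (viewed as discrete categories) and a relation $R\subseteq G\times M$ (viewed as a boolean profunctor $G^{\mathrm{op}}\times M\to\mathbf{2}=\{0,1\}$); write $gRm$ for $(g,m)\in R$ and $g\overline{R}m$ for $\neg(gRm)$. $P(G)=[G^{\mathrm{op}},\mathbf{2}]$ is the power set of $G$ ordered by inclusion, and $P(M)^{\mathrm{op}}=[M,\mathbf{2}]^{\mathrm{op}}$ is the power set of $M$ with the opposite order, both regarded as categories. The operators with superscripts are regarded as functors $P(G)\to P(M)^{\mathrm{op}}$ and those with subscripts as functors $P(M)^{\mathrm{op}}\to P(G)$. For $A\subseteq G$: $A^\Delta=\{m\in M\mid\forall g\in G,\ g\in A\Rightarrow gRm\}$, $A^\Pi=\{m\in M\mid\exists g\in G,\ g\in A\wedge gRm\}$. For $B\subseteq M$: $B_\Pi=\{g\in G\mid\exists m\in M,\ m\in B\wedge gRm\}$, $B_\nabla=\{g\in G\mid\exists m\in M,\ m\notin B\wedge g\overline{R}m\}$. The corresponding right adjoints are, respectively, $B_\Delta=\{g\in G\mid\forall m\in M,\ m\in B\Rightarrow gRm\}$ for $(-)^\Delta$, $B_N=\{g\in G\mid\forall m\in M,\ gRm\Rightarrow m\in B\}$ for $(-)^\Pi$,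 $A^N=\{m\in M\mid\forall g\in G,\ gRm\Rightarrow g\in A\}$ for $(-)_\Pi$, $A^\nabla=\{m\in M\mid\exists g\in G,\ g\notin A\wedge g\overline{R}m\}$ for $(-)_\nabla$; the right adjoint corresponding to a composition is the composition, in the opposite order, of the right adjoints of the factors. A functor $F\colon\mathcal{C}\to\mathcal{C}$ on a poset $\mathcal{C}$ is a closure operator if it is extensive ($A\le F(A)$), monotone ($A\le A'$ implies $F(A)\le F(A')$) and idempotent ($FF(A)=F(A)$).
   Formalization: The two Π operators preserve inclusion, so they are taken as functors to and from P(M), not P(M)^op; "any composition" means finite nonempty chains from P(G) whose intermediate orders match (Δ then ∇, Π then Π), since Π then ∇ and Δ then Π can fail to give a closure operator. *)

theory Defs
  imports "HOL-Algebra.Galois_Connection"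
begin

definition formal_context :: "'g set \<Rightarrow> 'm set \<Rightarrow> ('g \<times> 'm) set \<Rightarrow> bool"
  where "formal_context G M R \<longleftrightarrow> R \<subseteq> G \<times> M"

definition powerset_order :: "'a set \<Rightarrow> 'a set gorder"
  where "powerset_order X = \<lparr>carrier = Pow X, eq = (=), le = (\<subseteq>)\<rparr>"

definition closure_operator :: "('a, 'b) gorder_scheme \<Rightarrow> ('a \<Rightarrow> 'a) \<Rightarrow> bool"
  where "closure_operator C F \<longleftrightarrow>
    partial_order C \<and>
    F \<in> carrier C \<rightarrow> carrier C \<and>
    (\<forall>A\<in>carrier C. A \<sqsubseteq>\<^bsub>C\<^esub> F A) \<and>
    isotone C C F \<and>
    idempotent C F"

text \<open>The prefix \<open>up\<close> stands for a superscript (subsets of \<open>G\<close> to subsets of \<open>M\<close>), the prefix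
  \<open>low\<close> for a subscript (subsets of \<open>M\<close> to subsets of \<open>G\<close>).\<close>

definition up_Delta :: "'g set \<Rightarrow> 'm set \<Rightarrow> ('g \<times> 'm) set \<Rightarrow> 'g set \<Rightarrow> 'm set"
  where "up_Delta G M R A = {m \<in> M. \<forall>g\<in>G. g \<in> A \<longrightarrow> (g, m) \<in> R}"

definition low_Delta :: "'g set \<Rightarrow> 'm set \<Rightarrow> ('g \<times> 'm) set \<Rightarrow> 'm set \<Rightarrow> 'g set"
  where "low_Delta G M R B = {g \<in> G. \<forall>m\<in>M. m \<in> B \<longrightarrow> (g, m) \<in> R}"

definition up_Pi :: "'g set \<Rightarrow> 'm set \<Rightarrow> ('g \<times> 'm) set \<Rightarrow> 'g set \<Rightarrow> 'm set"
  where "up_Pi G M R A = {m \<in> M. \<exists>g\<in>G. g \<in> A \<and> (g, m) \<in> R}"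

definition low_N :: "'g set \<Rightarrow> 'm set \<Rightarrow> ('g \<times> 'm) set \<Rightarrow> 'm set \<Rightarrow> 'g set"
  where "low_N G M R B = {g \<in> G. \<forall>m\<in>M. (g, m) \<in> R \<longrightarrow> m \<in> B}"

definition low_Pi :: "'g set \<Rightarrow> 'm set \<Rightarrow> ('g \<times> 'm) set \<Rightarrow> 'm set \<Rightarrow> 'g set"
  where "low_Pi G M R B = {g \<in> G. \<exists>m\<in>M. m \<in> B \<and> (g, m) \<in> R}"

definition up_N :: "'g set \<Rightarrow> 'm set \<Rightarrow> ('g \<times> 'm) set \<Rightarrow> 'g set \<Rightarrow> 'm set"
  where "up_N G M R A = {m \<in> M. \<forall>g\<in>G. (g, m) \<in> R \<longrightarrow> g \<in> A}"

definition low_Nabla :: "'g set \<Rightarrow> 'm set \<Rightarrow> ('g \<times> 'm) set \<Rightarrow> 'm set \<Rightarrow> 'g set"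
  where "low_Nabla G M R B = {g \<in> G. \<exists>m\<in>M. m \<notin> B \<and> (g, m) \<notin> R}"

definition up_Nabla :: "'g set \<Rightarrow> 'm set \<Rightarrow> ('g \<times> 'm) set \<Rightarrow> 'g set \<Rightarrow> 'm set"
  where "up_Nabla G M R A = {m \<in> M. \<exists>g\<in>G. g \<notin> A \<and> (g, m) \<notin> R}"

text \<open>Each operator with its right adjoint. The superscript \<open>\<Delta>\<close> and the subscript \<open>\<nabla>\<close> reverse
  inclusion, so on the side of \<open>M\<close> they live on \<open>P(M)\<^sup>o\<^sup>p\<close>. The two operators \<open>\<Pi>\<close> preserve
  inclusion: as functors they go to and from \<open>P(M)\<close> itself, and they are not functors to and from
  \<open>P(M)\<^sup>o\<^sup>p\<close> (unless \<open>R\<close> is empty).\<close>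

definition Delta_adj ::
    "'g set \<Rightarrow> 'm set \<Rightarrow> ('g \<times> 'm) set \<Rightarrow> ('g set, 'm set) galois"
  where "Delta_adj G M R =
    \<lparr>orderA = powerset_order G, orderB = inv_gorder (powerset_order M),
     lower = up_Delta G M R, upper = low_Delta G M R\<rparr>"

definition up_Pi_adj ::
    "'g set \<Rightarrow> 'm set \<Rightarrow> ('g \<times> 'm) set \<Rightarrow> ('g set, 'm set) galois"
  where "up_Pi_adj G M R =
    \<lparr>orderA = powerset_order G, orderB = powerset_order M,
     lower = up_Pi G M R, upper = low_N G M R\<rparr>"

definition low_Pi_adj ::
    "'g set \<Rightarrow> 'm set \<Rightarrow> ('g \<times> 'm) set \<Rightarrow> ('m set, 'g set) galois"
  where "low_Pi_adj G M R =
    \<lparr>orderA = powerset_order M, orderB = powerset_order G,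
     lower = low_Pi G M R, upper = up_N G M R\<rparr>"

definition Nabla_adj ::
    "'g set \<Rightarrow> 'm set \<Rightarrow> ('g \<times> 'm) set \<Rightarrow> ('m set, 'g set) galois"
  where "Nabla_adj G M R =
    \<lparr>orderA = inv_gorder (powerset_order M), orderB = powerset_order G,
     lower = low_Nabla G M R, upper = up_Nabla G M R\<rparr>"

text \<open>All finite nonempty compositions starting at \<open>P(G)\<close>, ending on the side of \<open>M\<close>
  (\<open>composite_GM\<close>) or at \<open>P(G)\<close> (\<open>composite_GG\<close>). The operation \<open>\<circ>\<^sub>g\<close> composes the left adjoints
  and, in the opposite order, the right adjoints, but it does not require the middle posets to
  agree; the side conditions on \<open>orderB F\<close> do. They rule out, for instance, following the
  superscript \<open>\<Pi>\<close>, which ends in \<open>P(M)\<close>, by the subscript \<open>\<nabla>\<close>, which starts from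
  \<open>P(M)\<^sup>o\<^sup>p\<close>; for such pairs the resulting operator on \<open>P(G)\<close> need not be extensive.\<close>

inductive
  composite_GM :: "'g set \<Rightarrow> 'm set \<Rightarrow> ('g \<times> 'm) set \<Rightarrow> ('g set, 'm set) galois \<Rightarrow> bool" and
  composite_GG :: "'g set \<Rightarrow> 'm set \<Rightarrow> ('g \<times> 'm) set \<Rightarrow> ('g set, 'g set) galois \<Rightarrow> bool"
  for G :: "'g set" and M :: "'m set" and R :: "('g \<times> 'm) set"
where
  Delta: "composite_GM G M R (Delta_adj G M R)"
| up_Pi: "composite_GM G M R (up_Pi_adj G M R)"
| comp_low_Pi: "composite_GM G M R F \<Longrightarrow> orderB F = orderA (low_Pi_adj G M R)
    \<Longrightarrow> composite_GG G M R (low_Pi_adj G M R \<circ>\<^sub>g F)"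
| comp_Nabla: "composite_GM G M R F \<Longrightarrow> orderB F = orderA (Nabla_adj G M R)
    \<Longrightarrow> composite_GG G M R (Nabla_adj G M R \<circ>\<^sub>g F)"
| comp_Delta: "composite_GG G M R F \<Longrightarrow> orderB F = orderA (Delta_adj G M R)
    \<Longrightarrow> composite_GM G M R (Delta_adj G M R \<circ>\<^sub>g F)"
| comp_up_Pi: "composite_GG G M R F \<Longrightarrow> orderB F = orderA (up_Pi_adj G M R)
    \<Longrightarrow> composite_GM G M R (up_Pi_adj G M R \<circ>\<^sub>g F)"

end

theory Submission
  imports Defs
begin

text \<open>For each of the four operators the adjunction only rearranges quantifiers: both sides of
  the equivalence say that one condition holds at every pair \<open>(g, m)\<close>. For \<open>A \<subseteq> G\<close> and
  \<open>B \<subseteq> M\<close>: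

  \<^item> for \<open>\<Delta>\<close>, every \<open>g \<in> A\<close> and \<open>m \<in> B\<close> are related;
  \<^item> for the superscript \<open>\<Pi>\<close>, if \<open>g \<in> A\<close> and \<open>g\<close> is related to \<open>m\<close>, then \<open>m \<in> B\<close>;
  \<^item> for the subscript \<open>\<Pi>\<close>, if \<open>m \<in> B\<close> and \<open>g\<close> is related to \<open>m\<close>, then \<open>g \<in> A\<close>;
  \<^item> for \<open>\<nabla>\<close>, if \<open>g\<close> and \<open>m\<close> are not related, then \<open>g \<in> A\<close> or \<open>m \<in> B\<close>.

  Adjunctions compose when the middle posets agree, so every admissible composite is again an
  adjunction out of \<open>P(G)\<close> (\<open>composite_galois_connection\<close>). The composite of a left adjoint
  followed by its right adjoint is a closure operator, which is the general fact about Galois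
  connections recorded in \<open>galois_closure_operator\<close>.\<close>

lemma partial_order_powerset: "partial_order (powerset_order X)"
  by unfold_locales (auto simp: powerset_order_def)

lemma galois_connection_Delta: "galois_connection (Delta_adj G M R)"
  using partial_order_powerset[of G] partial_order.dual_order[OF partial_order_powerset[of M]]
  unfolding galois_connection_def galois_connection_axioms_def connection_def
  by (auto simp: Delta_adj_def powerset_order_def up_Delta_def low_Delta_def)

lemma galois_connection_up_Pi: "galois_connection (up_Pi_adj G M R)"
  using partial_order_powerset[of G] partial_order_powerset[of M]
  unfolding galois_connection_def galois_connection_axioms_def connection_def
  by (auto simp: up_Pi_adj_def powerset_order_def up_Pi_def low_N_def)

lemma galois_connection_low_Pi: "galois_connection (low_Pi_adj G M R)"
  using partial_order_powerset[of G] partial_order_powerset[of M]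
  unfolding galois_connection_def galois_connection_axioms_def connection_def
  by (auto simp: low_Pi_adj_def powerset_order_def low_Pi_def up_N_def)

lemma galois_connection_Nabla: "galois_connection (Nabla_adj G M R)"
  using partial_order_powerset[of G] partial_order.dual_order[OF partial_order_powerset[of M]]
  unfolding galois_connection_def galois_connection_axioms_def connection_def
  by (auto simp: Nabla_adj_def powerset_order_def low_Nabla_def up_Nabla_def)

text \<open>Extensivity is the unit of the adjunction, and idempotence is the triangle identity.\<close>

lemma galois_closure_operator:
  assumes "galois_connection F"
  shows "closure_operator (orderA F) (upper F \<circ> lower F)"
proof -
  interpret galois_connection F by (fact assms)
  show ?thesis
    unfolding closure_operator_def
    using is_order_A lower_closed upper_closed inflation gf_iso adjoint_idem2 by auto
qed

lemma orderA_comp_galcon: "orderA (F' \<circ>\<^sub>g F) = orderA F"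
  by (simp add: comp_galcon_def)

text \<open>The source of the composite must be carried through the induction together with the
  adjunction: it identifies the poset on which the closure operator acts.\<close>

lemma composite_galois_connection:
  "composite_GM G M R F \<Longrightarrow> galois_connection F \<and> orderA F = powerset_order G"
  "composite_GG G M R F' \<Longrightarrow> galois_connection F' \<and> orderA F' = powerset_order G"
proof (induction rule: composite_GM_composite_GG.inducts)
  case Delta
  show ?case using galois_connection_Delta by (simp add: Delta_adj_def)
next
  case up_Pi
  show ?case using galois_connection_up_Pi by (simp add: up_Pi_adj_def)
next
  case (comp_low_Pi F)
  then show ?case
    by (simp add: orderA_comp_galcon comp_galcon_closed galois_connection_low_Pi)
next
  case (comp_Nabla F)
  then show ?case
    by (simp add: orderA_comp_galcon comp_galcon_closed galois_connection_Nabla)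
next
  case (comp_Delta F)
  then show ?case
    by (simp add: orderA_comp_galcon comp_galcon_closed galois_connection_Delta)
next
  case (comp_up_Pi F)
  then show ?case
    by (simp add: orderA_comp_galcon comp_galcon_closed galois_connection_up_Pi)
qed

theorem mainTheorem3:
  fixes G :: "'g set" and M :: "'m set" and R :: "('g \<times> 'm) set"
  assumes "formal_context G M R"
  shows "galois_connection (Delta_adj G M R) \<and>
    galois_connection (up_Pi_adj G M R) \<and>
    galois_connection (low_Pi_adj G M R) \<and>
    galois_connection (Nabla_adj G M R) \<and>
    (\<forall>F. composite_GM G M R F \<longrightarrow>
       closure_operator (powerset_order G) (upper F \<circ> lower F)) \<and>
    (\<forall>F. composite_GG G M R F \<longrightarrow>
       closure_operator (powerset_order G) (upper F \<circ> lower F))"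
  using galois_connection_Delta galois_connection_up_Pi
    galois_connection_low_Pi galois_connection_Nabla
    composite_galois_connection galois_closure_operator
  by metis

end
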